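(* Let $G$ be a connected graph with $n$ vertices, where $n\geq 3$. (1) If $n\equiv 1\pmod 3$, then $\kappa(G;K_{1,2})$ is well-defined. (2) If $n\equiv 2\pmod 3$, then $\kappa(G;K_{1,2})$ is well-defined if and only if $G$ is isomorphic neither to the cycle $C_5$ nor to the complete graph $K_n$. (3) If $n\equiv 0\pmod 3$ and there exist three distinct vertices $u,v,w$ of $G$ such that $N_G(u)\cap (N_G(v,w)\cup\{v,w\})=\emptyset$, then $\kappa(G;K_{1,2})$ is well-defined.
   Context: All graphs are finite, simple and undirected. $K_{1,2}$ is the path on three vertices (two edges). A graph is trivial if it has exactly one vertex. $N_G(u)$ is the set of neighbors of $u$ in $G$, and $N_G(v,w)$ is the set of vertices adjacent to $v$ or to $w$, so that $N_G(v,w)\cup\{v,w\}=N_G(v)\cup N_G(w)\cup\{v,w\}$. A $K_{1,2}$-structure-cut of a connected graph $G$ is a set $\mathcal{F}$ of pairwise vertex-disjoint subgraphs of $G$ (not necessarily induced), each isomorphic to $K_{1,2}$, such that $G-V(\mathcal{F})$ (the graph obtained by deleting all vertices of all members of $\mathcal{F}$) is disconnected or trivial. The $K_{1,2}$-structure-connectivity $\kappa(G;K_{1,2})$ is the minimum cardinality of a $K_{1,2}$-structure-cut of $G$; it is called well-defined if $G$ has at least one $K_{1,2}$-structure-cut. *)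

theory Defs
  imports "Graph_Theory.Kuratowski" "Graph_Theory.Digraph_Isomorphism"
begin

text \<open>
  Finite simple undirected graphs are the symmetric loop-free digraphs of the locale
  \<open>pair_graph\<close>: the edge \<open>uv\<close> is the pair of arcs \<open>(u,v)\<close>, \<open>(v,u)\<close>.  The locale admits the null
  graph, which the library counts as not \<open>connected\<close>.
\<close>

definition neighborhood :: "'a pair_pre_digraph \<Rightarrow> 'a \<Rightarrow> 'a set" where
  "neighborhood G u = {x \<in> pverts G. (u, x) \<in> parcs G}"

definition neighborhood2 :: "'a pair_pre_digraph \<Rightarrow> 'a \<Rightarrow> 'a \<Rightarrow> 'a set" where
  "neighborhood2 G v w = {x \<in> pverts G. (v, x) \<in> parcs G \<or> (w, x) \<in> parcs G}"

definition trivial_graph :: "('a, 'b) pre_digraph \<Rightarrow> bool" where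
  "trivial_graph G \<longleftrightarrow> card (verts G) = 1"

text \<open>The null graph is neither disconnected nor trivial.\<close>

definition disconnected :: "('a, 'b) pre_digraph \<Rightarrow> bool" where
  "disconnected G \<longleftrightarrow> verts G \<noteq> {} \<and> \<not> connected G"

definition K12_structure_cut :: "'a pair_pre_digraph \<Rightarrow> 'a pair_pre_digraph set \<Rightarrow> bool" where
  "K12_structure_cut G F \<longleftrightarrow>
    (\<forall>H\<in>F. subgraph (with_proj H) (with_proj G) \<and> K\<^bsub>1,2\<^esub> (with_proj H)) \<and>
    (\<forall>H\<in>F. \<forall>H'\<in>F. H \<noteq> H' \<longrightarrow> pverts H \<inter> pverts H' = {}) \<and>
    (let R = with_proj G \<restriction> (pverts G - (\<Union>H\<in>F. pverts H))
     in disconnected R \<or> trivial_graph R)"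

text \<open>The value below is meaningful only if it is well-defined in the sense of the next definition.\<close>

definition K12_structure_connectivity :: "'a pair_pre_digraph \<Rightarrow> nat" where
  "K12_structure_connectivity G = (LEAST k. \<exists>F. K12_structure_cut G F \<and> card F = k)"

definition K12_structure_connectivity_well_defined :: "'a pair_pre_digraph \<Rightarrow> bool" where
  "K12_structure_connectivity_well_defined G \<longleftrightarrow> (\<exists>F. K12_structure_cut G F)"

text \<open>The cycle \<open>C\<^sub>n\<close> on \<open>{0..<n}\<close>, a simple graph for \<open>n \<ge> 3\<close>.\<close>

definition cycle_graph :: "nat \<Rightarrow> nat pair_pre_digraph" where
  "cycle_graph n = \<lparr> pverts = {0..<n},
     parcs = {(i, j). i < n \<and> j < n \<and> (j = Suc i mod n \<or> i = Suc j mod n)} \<rparr>"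

end

theory Submission
  imports Defs "HOL-Library.Disjoint_Sets"
begin

text \<open>
  Only the vertex sets of the members of a structure cut matter, and these are exactly the disjoint
  families of triples of vertices that carry a path.  Hence \<open>\<kappa>(G; K\<^sub>1\<^sub>,\<^sub>2)\<close> fails to be well-defined
  iff every packing of such triples leaves a residual set that is empty or connected with at least
  two vertices.  Call a vertex set with this property \<^emph>\<open>uncuttable\<close>
  (\<open>K12_well_defined_iff_not_uncuttable\<close>).  The whole proof rests on the fact that removing a path
  triple from an uncuttable set leaves an uncuttable set (\<open>uncuttable_diff\<close>), so that induction on
  the vertex set applies.

  An uncuttable set with at least three vertices is connected and thus contains a path triple.
  Removing triples one after the other therefore leads to at most two remaining vertices, and a
  single remaining vertex is forbidden.  This excludes \<open>n \<equiv> 1\<close> modulo 3.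

  Let \<open>n \<equiv> 2\<close>.  With five vertices, the complement of every path triple must be an edge, which
  leaves only \<open>K\<^sub>5\<close> and \<open>C\<^sub>5\<close> (\<open>uncuttable5\<close>).  With eight or more vertices, removing a path triple
  yields by induction a complete graph or \<open>C\<^sub>5\<close>.  The second case is impossible: each edge of the
  \<open>C\<^sub>5\<close> together with the removed path forms an uncuttable set with five vertices.  If none of
  these is complete, then exactly one end of each edge of the odd cycle is adjacent to the first
  vertex of the path; if one is complete, then all are, and another removal leaves a set that is
  neither complete nor a five-cycle (\<open>uncuttable8_not_five_cycle\<close>).  So every removal of a triple leaves a complete
  graph.  Given two vertices \<open>x\<close> and \<open>z\<close>, one such complete graph contains a triple that avoids \<open>x\<close>
  and \<open>z\<close>, and removing that triple instead shows that \<open>x\<close> and \<open>z\<close> are adjacent.  Conversely,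
  every packing in \<open>K\<^sub>n\<close> or \<open>C\<^sub>5\<close> leaves at least two vertices, which remain connected.

  Finally let \<open>u\<close> have no neighbor in the closed neighborhoods of \<open>v\<close> and \<open>w\<close>
  (\<open>uncuttable_no_far_triple\<close>).  In a minimal uncuttable set that contains \<open>u\<close>, \<open>v\<close>, \<open>w\<close>, the other
  vertices span a graph without path triples, that is, isolated vertices and isolated edges.  As
  the set is connected, \<open>u\<close> is joined to \<open>v\<close> or \<open>w\<close> by a \<^emph>\<open>bridge\<close> \<open>u - a - b - t\<close> with
  \<open>t \<in> {v, w}\<close>.  Removing suitable triples, among them \<open>{u, a, b}\<close> and \<open>{a, b, t}\<close>, shows in turn
  that every neighbor of \<open>u\<close> starts a bridge, that two bridges cannot share their end \<open>t\<close>, and that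
  both \<open>v\<close> and \<open>w\<close> are ends.  So \<open>u\<close> has exactly two neighbors, and removing both bridges up to
  \<open>u\<close> isolates \<open>u\<close>, which contradicts uncuttability.
\<close>

section \<open>Packings of paths on three vertices\<close>

context pair_graph
begin

abbreviation adj :: "'a \<Rightarrow> 'a \<Rightarrow> bool" (infix \<open>\<frown>\<close> 50) where
  "x \<frown> y \<equiv> (x, y) \<in> parcs G"

definition path_triple :: "'a set \<Rightarrow> bool" where
  "path_triple T \<longleftrightarrow> (\<exists>x y z. T = {x, y, z} \<and> x \<noteq> z \<and> x \<frown> y \<and> y \<frown> z)"

definition triple_packing :: "'a set \<Rightarrow> 'a set set \<Rightarrow> bool" where
  "triple_packing S M \<longleftrightarrow> (\<forall>T\<in>M. T \<subseteq> S \<and> path_triple T) \<and> disjoint M"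

text \<open>
  Connectedness of the subgraph induced by \<open>S\<close>, in the form that no proper part of \<open>S\<close> is separated
  from the rest.  The empty set counts as linked, in accordance with the fact that an empty residual
  graph is not a cut.
\<close>

definition linked :: "'a set \<Rightarrow> bool" where
  "linked S \<longleftrightarrow> (\<forall>X. X \<subseteq> S \<and> X \<noteq> {} \<and> X \<noteq> S \<longrightarrow> (\<exists>x\<in>X. \<exists>y\<in>S - X. x \<frown> y))"

text \<open>
  A single residual vertex is a trivial graph and hence a cut; it is linked and has to be excluded
  by its cardinality.
\<close>

definition uncuttable :: "'a set \<Rightarrow> bool" where
  "uncuttable S \<longleftrightarrow> (\<forall>M. triple_packing S M \<longrightarrow> linked (S - \<Union>M) \<and> card (S - \<Union>M) \<noteq> 1)"

definition complete_on :: "'a set \<Rightarrow> bool" where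
  "complete_on S \<longleftrightarrow> (\<forall>x\<in>S. \<forall>y\<in>S. x \<noteq> y \<longrightarrow> x \<frown> y)"

lemma adj_sym: "x \<frown> y \<longleftrightarrow> y \<frown> x"
  using arcs_symmetric by blast

lemma not_adj_refl: "\<not> x \<frown> x"
  using no_loops' by blast

lemma path_tripleI: "x \<frown> y \<Longrightarrow> y \<frown> z \<Longrightarrow> x \<noteq> z \<Longrightarrow> path_triple {x, y, z}"
  by (auto simp: path_triple_def)

lemma card_path_triple: "path_triple T \<Longrightarrow> card T = 3"
  unfolding path_triple_def by (auto simp: card_insert_if not_adj_refl)

lemma path_triple_neighbor: "path_triple T \<Longrightarrow> x \<in> T \<Longrightarrow> \<exists>y\<in>T. x \<frown> y"
  unfolding path_triple_def using arcs_symmetric by fastforce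

lemma linkedD:
  assumes "linked S" "X \<subseteq> S" "p \<in> X" "q \<in> S" "q \<notin> X"
  obtains x y where "x \<in> X" "y \<in> S" "y \<notin> X" "x \<frown> y"
  using assms unfolding linked_def by (metis DiffE empty_iff)

lemma linked_imp_neighbor:
  assumes "linked S" "p \<in> S" "q \<in> S" "p \<noteq> q"
  obtains y where "y \<in> S" "p \<frown> y"
  by (rule linkedD[OF assms(1), of "{p}" p q]) (use assms that in auto)

text \<open>
  A vertex that misses some other vertex misses one at distance exactly two: an edge leaves its
  closed neighborhood.
\<close>

lemma linked_not_complete:
  assumes "linked S" "p \<in> S" "q \<in> S" "p \<noteq> q" "\<not> p \<frown> q"
  obtains y z where "y \<in> S" "z \<in> S" "p \<frown> y" "y \<frown> z" "p \<noteq> z" "\<not> p \<frown> z"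
proof -
  obtain y z where "y \<in> {y \<in> S. y = p \<or> p \<frown> y}" "z \<in> S" "z \<notin> {y \<in> S. y = p \<or> p \<frown> y}" "y \<frown> z"
    by (rule linkedD[OF assms(1), of "{y \<in> S. y = p \<or> p \<frown> y}" p q]) (use assms in auto)
  then show thesis
    using that[of y z] by auto
qed

lemma linked_imp_path_triple:
  assumes "linked S" "card S \<ge> 3"
  obtains T where "T \<subseteq> S" "path_triple T"
proof (cases "\<exists>p\<in>S. \<exists>q\<in>S. p \<noteq> q \<and> \<not> p \<frown> q")
  case True
  then obtain p y z where "p \<in> S" "y \<in> S" "z \<in> S" "p \<frown> y" "y \<frown> z" "p \<noteq> z"
    using linked_not_complete[OF assms(1)] by metis
  then show ?thesis
    using that[of "{p, y, z}"] path_tripleI by blast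
next
  case False
  obtain T where "T \<subseteq> S" "card T = 3"
    using assms(2) obtain_subset_with_card_n by metis
  moreover then obtain x y z where "T = {x, y, z}" "x \<noteq> y" "y \<noteq> z" "x \<noteq> z"
    by (auto simp: card_3_iff)
  ultimately show ?thesis
    using that[of T] path_tripleI[of x y z] False by blast
qed

lemma complete_on_imp_linked: "complete_on S \<Longrightarrow> linked S"
  unfolding linked_def
proof (intro allI impI)
  fix X assume "complete_on S" and X: "X \<subseteq> S \<and> X \<noteq> {} \<and> X \<noteq> S"
  moreover obtain x y where "x \<in> X" "y \<in> S - X"
    using X by blast
  ultimately show "\<exists>x\<in>X. \<exists>y\<in>S - X. x \<frown> y"
    unfolding complete_on_def by (metis DiffD1 DiffD2 subsetD)
qed

lemma uncuttable_linked: "uncuttable S \<Longrightarrow> linked S"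
  and uncuttable_card: "uncuttable S \<Longrightarrow> card S \<noteq> 1"
  unfolding uncuttable_def triple_packing_def by (auto dest: spec[of _ "{}"])

text \<open>
  A packing of \<open>S - T\<close> becomes a packing of \<open>S\<close> with the same residual set when \<open>T\<close> is added to it.
\<close>

lemma uncuttable_diff:
  assumes "uncuttable S" "path_triple T" "T \<subseteq> S"
  shows "uncuttable (S - T)"
  unfolding uncuttable_def
proof (intro allI impI)
  fix M assume M: "triple_packing (S - T) M"
  have "disjoint (insert T M)"
    using M unfolding triple_packing_def disjoint_def by blast
  then have "triple_packing S (insert T M)"
    using M assms unfolding triple_packing_def by blast
  moreover have "S - \<Union>(insert T M) = S - T - \<Union>M"
    by blast
  ultimately show "linked (S - T - \<Union>M) \<and> card (S - T - \<Union>M) \<noteq> 1"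
    using assms(1) unfolding uncuttable_def by metis
qed

lemma uncuttable_diff3:
  assumes "uncuttable S" "x \<frown> y" "y \<frown> z" "x \<noteq> z" "x \<in> S" "y \<in> S" "z \<in> S"
  shows "uncuttable (S - {x, y, z})"
  using assms by (intro uncuttable_diff path_tripleI) auto

section \<open>Structure cuts and packings\<close>

lemma connected_induce_iff_linked:
  assumes "S \<subseteq> pverts G" "S \<noteq> {}"
  shows "connected (with_proj G \<restriction> S) \<longleftrightarrow> linked S"
proof -
  let ?R = "{(x, y). x \<in> S \<and> y \<in> S \<and> x \<frown> y}"
  have R: "parcs (mk_symmetric (with_proj G \<restriction> S)) = ?R"
    using adj_sym by (fastforce simp: parcs_mk_symmetric induce_subgraph_def)
  have conn: "connected (with_proj G \<restriction> S) \<longleftrightarrow> (\<forall>x\<in>S. \<forall>y\<in>S. (x, y) \<in> rtrancl_on S ?R)"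
    using assms(2) by (simp add: connected_def strongly_connected_def reachable_def R)
  show ?thesis
  proof
    assume *: "connected (with_proj G \<restriction> S)"
    show "linked S"
      unfolding linked_def
    proof (intro allI impI, rule ccontr)
      fix X assume X: "X \<subseteq> S \<and> X \<noteq> {} \<and> X \<noteq> S" and no: "\<not> (\<exists>x\<in>X. \<exists>y\<in>S - X. x \<frown> y)"
      then obtain p q where pq: "p \<in> X" "q \<in> S - X"
        by blast
      then have "(p, q) \<in> rtrancl_on S ?R"
        using * X unfolding conn by blast
      then have "q \<in> X"
        by (induction rule: rtrancl_on_induct) (use pq no in auto)
      then show False
        using pq by blast
    qed
  next
    assume linked: "linked S"
    have "(p, q) \<in> rtrancl_on S ?R" if pq: "p \<in> S" "q \<in> S" for p q
    proof (rule ccontr)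
      assume no: "(p, q) \<notin> rtrancl_on S ?R"
      define X where "X = {y \<in> S. (p, y) \<in> rtrancl_on S ?R}"
      obtain x y where "x \<in> X" "y \<in> S" "y \<notin> X" "x \<frown> y"
        by (rule linkedD[OF linked, of X p q]) (use pq no in \<open>auto simp: X_def\<close>)
      then show False
        unfolding X_def by (auto intro: rtrancl_on_into_rtrancl_on)
    qed
    then show "connected (with_proj G \<restriction> S)"
      unfolding conn by blast
  qed
qed

lemma path_triple_if_K12_subgraph:
  assumes "subgraph (with_proj H) (with_proj G)" "K\<^bsub>1,2\<^esub> (with_proj H)"
  shows "path_triple (pverts H)" "pverts H \<subseteq> pverts G"
proof -
  obtain U V where UV: "pverts H = U \<union> V" "U \<inter> V = {}" "card U = 1" "card V = 2"
    "parcs H = U \<times> V \<union> V \<times> U"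
    using assms(2) unfolding complete_bipartite_digraph_pair_def by blast
  obtain y where y: "U = {y}"
    using UV(3) card_1_singletonE by metis
  obtain x z where xz: "V = {x, z}" "x \<noteq> z"
    using UV(4) by (auto simp: card_2_iff)
  have "parcs H \<subseteq> parcs G"
    using assms(1) by (auto simp: subgraph_def)
  then have "x \<frown> y" "y \<frown> z"
    using UV(5) y xz by auto
  moreover have "pverts H = {x, y, z}"
    using UV(1) y xz by auto
  ultimately show "path_triple (pverts H)"
    using path_tripleI xz(2) by simp
  show "pverts H \<subseteq> pverts G"
    using assms(1) by (auto simp: subgraph_def)
qed

lemma K12_subgraph_if_path_triple:
  assumes "path_triple T"
  shows "\<exists>H. pverts H = T \<and> subgraph (with_proj H) (with_proj G) \<and> K\<^bsub>1,2\<^esub> (with_proj H)"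
proof -
  obtain x y z where xyz: "T = {x, y, z}" "x \<noteq> z" "x \<frown> y" "y \<frown> z"
    using assms unfolding path_triple_def by blast
  have ne: "x \<noteq> y" "y \<noteq> z"
    using xyz not_adj_refl by auto
  define H where "H = \<lparr>pverts = T, parcs = {y} \<times> {x, z} \<union> {x, z} \<times> {y}\<rparr>"
  have K: "K\<^bsub>1,2\<^esub> (with_proj H)"
    unfolding complete_bipartite_digraph_pair_def
    by (intro conjI exI[of _ "{y}"] exI[of _ "{x, z}"]) (use xyz(2) ne in \<open>auto simp: H_def xyz(1)\<close>)
  have "wf_digraph (with_proj H)"
    unfolding wf_digraph_wp_iff pair_wf_digraph_def H_def xyz(1) by auto
  moreover have "pverts H \<subseteq> pverts G" "parcs H \<subseteq> parcs G"
    unfolding H_def xyz(1) using xyz adj_sym[of y x] adj_sym[of z y] in_arcsD1 in_arcsD2 by auto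
  ultimately have "subgraph (with_proj H) (with_proj G)"
    by (auto intro!: subgraphI wf_digraph)
  then show ?thesis
    using K by (auto intro!: exI[of _ H] simp: H_def)
qed

text \<open>
  Distinct members of a structure cut may not share vertices, so the vertex sets of its members form
  a packing, and a packing is turned into a structure cut by choosing one path for each triple.
\<close>

lemma K12_well_defined_iff_not_uncuttable:
  "K12_structure_connectivity_well_defined G \<longleftrightarrow> \<not> uncuttable (pverts G)"
proof
  have cut_iff: "disconnected (with_proj G \<restriction> S) \<or> trivial_graph (with_proj G \<restriction> S) \<longleftrightarrow> \<not> (linked S \<and> card S \<noteq> 1)"
    if "S \<subseteq> pverts G" for S
    using connected_induce_iff_linked[OF that]
    by (cases "S = {}") (auto simp: disconnected_def trivial_graph_def linked_def)
  {
    assume "K12_structure_connectivity_well_defined G"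
    then obtain F where F: "K12_structure_cut G F"
      unfolding K12_structure_connectivity_well_defined_def by blast
    have sub: "\<forall>H\<in>F. subgraph (with_proj H) (with_proj G) \<and> K\<^bsub>1,2\<^esub> (with_proj H)"
      and disj: "\<forall>H\<in>F. \<forall>H'\<in>F. H \<noteq> H' \<longrightarrow> pverts H \<inter> pverts H' = {}"
      and cut: "disconnected (with_proj G \<restriction> (pverts G - \<Union>(pverts ` F))) \<or>
        trivial_graph (with_proj G \<restriction> (pverts G - \<Union>(pverts ` F)))"
      using F unfolding K12_structure_cut_def Let_def by auto
    have "path_triple T \<and> T \<subseteq> pverts G" if "T \<in> pverts ` F" for T
      using that sub path_triple_if_K12_subgraph by fast
    moreover have "disjoint (pverts ` F)"
      using disj unfolding disjoint_def by fast
    ultimately have "triple_packing (pverts G) (pverts ` F)"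
      unfolding triple_packing_def by blast
    then show "\<not> uncuttable (pverts G)"
      using cut cut_iff[of "pverts G - \<Union>(pverts ` F)"] unfolding uncuttable_def by blast
  next
    assume "\<not> uncuttable (pverts G)"
    then obtain M where M: "triple_packing (pverts G) M"
      "\<not> (linked (pverts G - \<Union>M) \<and> card (pverts G - \<Union>M) \<noteq> 1)"
      unfolding uncuttable_def by blast
    obtain h where h: "\<And>T. T \<in> M \<Longrightarrow> pverts (h T) = T \<and>
      subgraph (with_proj (h T)) (with_proj G) \<and> K\<^bsub>1,2\<^esub> (with_proj (h T))"
      using K12_subgraph_if_path_triple M(1) unfolding triple_packing_def by metis
    have union: "(\<Union>H\<in>h ` M. pverts H) = \<Union>M"
      using h by auto
    have "\<forall>H\<in>h ` M. \<forall>H'\<in>h ` M. H \<noteq> H' \<longrightarrow> pverts H \<inter> pverts H' = {}"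
    proof (intro ballI impI, elim imageE)
      fix H H' T T' assume H: "H \<noteq> H'" "H = h T" "H' = h T'" and T: "T \<in> M" "T' \<in> M"
      have "T \<inter> T' = {}"
        using H T M(1) disjointD[of M T T'] unfolding triple_packing_def by auto
      then show "pverts H \<inter> pverts H' = {}"
        using h[OF T(1)] h[OF T(2)] H(2,3) by simp
    qed
    moreover have "\<forall>H\<in>h ` M. subgraph (with_proj H) (with_proj G) \<and> K\<^bsub>1,2\<^esub> (with_proj H)"
      using h by simp
    moreover have "disconnected (with_proj G \<restriction> (pverts G - \<Union>M)) \<or> trivial_graph (with_proj G \<restriction> (pverts G - \<Union>M))"
      unfolding cut_iff[OF Diff_subset] by (rule M(2))
    ultimately have "K12_structure_cut G (h ` M)"
      unfolding K12_structure_cut_def Let_def union by (intro conjI)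
    then show "K12_structure_connectivity_well_defined G"
      unfolding K12_structure_connectivity_well_defined_def by blast
  }
qed

section \<open>Orders congruent to 1 modulo 3\<close>

text \<open>
  Path triples can be split off one after the other until at most two vertices remain.
\<close>

lemma uncuttable_card_mod_3:
  assumes "finite S" "uncuttable S"
  shows "card S mod 3 \<noteq> 1"
  using assms
proof (induction S rule: finite_psubset_induct)
  case (psubset S)
  show ?case
  proof (cases "card S \<ge> 3")
    case True
    then obtain T where T: "T \<subseteq> S" "path_triple T"
      using linked_imp_path_triple uncuttable_linked psubset.prems by blast
    have "card (S - T) = card S - 3" "T \<noteq> {}"
      using T card_path_triple[of T] psubset.hyps by (auto simp: card_Diff_subset finite_subset)
    moreover have "card (S - T) mod 3 \<noteq> 1"
      using psubset.IH[of "S - T"] uncuttable_diff psubset.prems T \<open>T \<noteq> {}\<close> by blast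
    ultimately show ?thesis
      using True by (simp add: le_mod_geq)
  next
    case False
    then show ?thesis
      using uncuttable_card[OF psubset.prems] by simp
  qed
qed

section \<open>Complete graphs and the five-cycle have no structure cut\<close>

lemma card_residual:
  assumes "finite S" "triple_packing S M"
  shows "card S = card (S - \<Union>M) + 3 * card M"
proof -
  have "card (\<Union>M) = 3 * card M"
  proof -
    have "card (\<Union>M) = sum card M"
      using assms unfolding triple_packing_def
      by (intro card_Union_disjoint) (auto simp: disjoint_def pairwise_def disjnt_def intro: finite_subset)
    also have "\<dots> = sum (\<lambda>_. 3) M"
      using assms(2) card_path_triple unfolding triple_packing_def by (intro sum.cong) auto
    finally show ?thesis by simp
  qed
  moreover have "\<Union>M \<subseteq> S"
    using assms(2) unfolding triple_packing_def by blast
  ultimately show ?thesis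
    using assms(1) by (metis add.commute card_Diff_subset card_mono finite_subset le_add_diff_inverse)
qed

lemma complete_imp_uncuttable:
  assumes "finite S" "complete_on S" "card S mod 3 = 2"
  shows "uncuttable S"
  unfolding uncuttable_def
proof (intro allI impI conjI)
  fix M assume M: "triple_packing S M"
  show "linked (S - \<Union>M)"
    using assms(2) by (intro complete_on_imp_linked) (simp add: complete_on_def)
  have "card (S - \<Union>M) mod 3 = 2"
    using card_residual[OF assms(1) M] assms(3) by simp
  then show "card (S - \<Union>M) \<noteq> 1"
    by auto
qed

definition five_cycle :: "'a \<Rightarrow> 'a \<Rightarrow> 'a \<Rightarrow> 'a \<Rightarrow> 'a \<Rightarrow> bool" where
  "five_cycle a b c d e \<longleftrightarrow> distinct [a, b, c, d, e] \<and>
    a \<frown> b \<and> b \<frown> c \<and> c \<frown> d \<and> d \<frown> e \<and> e \<frown> a \<and>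
    \<not> a \<frown> c \<and> \<not> b \<frown> d \<and> \<not> c \<frown> e \<and> \<not> d \<frown> a \<and> \<not> e \<frown> b"

lemma five_cycle_rotate: "five_cycle a b c d e \<Longrightarrow> five_cycle b c d e a"
  unfolding five_cycle_def by auto

lemma five_cycle_start_at:
  assumes "five_cycle v w x y z" "q \<in> {v, w, x, y, z}"
  obtains c d e f where "{v, w, x, y, z} = {q, c, d, e, f}" "five_cycle q c d e f"
proof -
  note rot = five_cycle_rotate[OF assms(1)]
  note rot2 = five_cycle_rotate[OF rot]
  note rot3 = five_cycle_rotate[OF rot2]
  note rot4 = five_cycle_rotate[OF rot3]
  consider "q = v" | "q = w" | "q = x" | "q = y" | "q = z"
    using assms(2) by blast
  then show thesis
  proof cases
    case 1 with that[of w x y z] assms(1) show ?thesis by blast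
  next
    case 2 with that[of x y z v] rot show ?thesis by blast
  next
    case 3 with that[of y z v w] rot2 show ?thesis by blast
  next
    case 4 with that[of z v w x] rot3 show ?thesis by blast
  next
    case 5 with that[of v w x y] rot4 show ?thesis by blast
  qed
qed

text \<open>
  If two vertices of the cycle are nonadjacent, then one of the other three vertices is their common
  neighbor and is isolated among those three, so that these carry no path.
\<close>

lemma complete_on_five_cycle_minus_triple:
  assumes cyc: "five_cycle a b c d e" and T: "path_triple T" "T \<subseteq> {a, b, c, d, e}"
  shows "complete_on ({a, b, c, d, e} - T)"
  unfolding complete_on_def
proof (intro ballI impI, rule ccontr)
  fix x y
  assume x: "x \<in> {a, b, c, d, e} - T" and y: "y \<in> {a, b, c, d, e} - T" and "x \<noteq> y"
  assume no: "\<not> x \<frown> y"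
  obtain p q r s where c: "{a, b, c, d, e} = {x, p, q, r, s}" "five_cycle x p q r s"
    using five_cycle_start_at[OF cyc DiffD1[OF x]] by metis
  have y_cases: "y = q \<or> y = r"
  proof -
    have "y \<in> {x, p, q, r, s}"
      using y c(1) by simp
    moreover have "x \<frown> p" "x \<frown> s"
      using c(2) adj_sym[of s x] unfolding five_cycle_def by auto
    ultimately show ?thesis
      using no \<open>x \<noteq> y\<close> by blast
  qed
  have "card T = 3"
    using T(1) card_path_triple by blast
  \<comment> \<open>The triple is all that remains of the cycle, and its member between \<open>x\<close> and \<open>y\<close> has no neighbor in it.\<close>
  have "T \<subseteq> {p, q, r, s} - {y}"
    using T(2) x y unfolding c(1) by auto
  moreover have "card ({p, q, r, s} - {y}) = 3"
    using c(2) y_cases unfolding five_cycle_def by auto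
  ultimately have "T = {p, q, r, s} - {y}"
    using \<open>card T = 3\<close> by (metis card_subset_eq finite.emptyI finite.insertI finite_Diff)
  then have "T = {p, r, s} \<or> T = {s, p, q}"
    using c(2) y_cases unfolding five_cycle_def by auto
  then show False
  proof
    assume "T = {p, r, s}"
    then show False
      using path_triple_neighbor[OF T(1), of p] c(2) adj_sym[of p s] not_adj_refl unfolding five_cycle_def by auto
  next
    assume "T = {s, p, q}"
    then show False
      using path_triple_neighbor[OF T(1), of s] c(2) adj_sym[of s q] not_adj_refl unfolding five_cycle_def by auto
  qed
qed

lemma five_cycle_imp_uncuttable:
  assumes "five_cycle a b c d e" "linked {a, b, c, d, e}"
  shows "uncuttable {a, b, c, d, e}"
  unfolding uncuttable_def
proof (intro allI impI)
  let ?S = "{a, b, c, d, e}"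
  fix M assume M: "triple_packing ?S M"
  have "card ?S = 5"
    using assms(1) unfolding five_cycle_def by simp
  then have card: "5 = card (?S - \<Union>M) + 3 * card M"
    using card_residual[OF _ M] by simp
  show "linked (?S - \<Union>M) \<and> card (?S - \<Union>M) \<noteq> 1"
  proof (cases "M = {}")
    case True
    then show ?thesis
      using assms(2) \<open>card ?S = 5\<close> by simp
  next
    case False
    then obtain T where T: "T \<in> M" "path_triple T" "T \<subseteq> ?S"
      using M unfolding triple_packing_def by blast
    have "?S - \<Union>M \<subseteq> ?S - T"
      using T(1) by (intro Diff_mono order_refl) (rule Union_upper)
    then have "complete_on (?S - \<Union>M)"
      using complete_on_five_cycle_minus_triple[OF assms(1) T(2,3)] unfolding complete_on_def by (meson subsetD)
    then have "linked (?S - \<Union>M)"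
      by (rule complete_on_imp_linked)
    moreover have "card (?S - \<Union>M) \<noteq> 1"
      using card by presburger
    ultimately show ?thesis ..
  qed
qed

section \<open>Orders congruent to 2 modulo 3\<close>

lemma uncuttable5_complement:
  assumes "uncuttable S" "S = {a, b, c, d, e}" "distinct [a, b, c, d, e]" "a \<frown> b" "b \<frown> c"
  shows "d \<frown> e"
proof -
  have "uncuttable (S - {a, b, c})"
    using assms by (intro uncuttable_diff3) auto
  moreover have "S - {a, b, c} = {d, e}"
    using assms by auto
  ultimately have "linked {d, e}"
    using uncuttable_linked by metis
  then obtain y where "y \<in> {d, e}" "d \<frown> y"
    using linked_imp_neighbor[of "{d, e}" d e] assms(3) by auto
  then show ?thesis
    using not_adj_refl by auto
qed

text \<open>
  Start from a path \<open>x - y - z\<close> with nonadjacent ends and let \<open>d\<close>, \<open>e\<close> be the other two vertices.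
  Contraposition of \<open>uncuttable5_complement\<close> forbids a path on the complement of a nonadjacent pair.
  Thus \<open>y\<close> has no neighbor among \<open>d\<close>, \<open>e\<close>, and an edge from \<open>{d, e}\<close> to \<open>{x, z}\<close>, which exists by
  connectedness, forces the other edges of a five-cycle.
\<close>

lemma uncuttable5:
  assumes unc: "uncuttable S" and "card S = 5" and nc: "\<not> complete_on S"
  obtains a b c d e where "S = {a, b, c, d, e}" "five_cycle a b c d e"
proof -
  note found = that
  obtain p q where "p \<in> S" "q \<in> S" "p \<noteq> q" "\<not> p \<frown> q"
    using nc unfolding complete_on_def by blast
  then obtain x y z where xyz: "x \<in> S" "y \<in> S" "z \<in> S" "x \<frown> y" "y \<frown> z" "x \<noteq> z" "\<not> x \<frown> z"
    using linked_not_complete[OF uncuttable_linked[OF unc]] by metis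
  have fin: "finite S"
    using \<open>card S = 5\<close> card.infinite by fastforce
  have ne: "x \<noteq> y" "y \<noteq> z"
    using xyz not_adj_refl by auto
  have "card (S - {x, y, z}) = 2"
    using xyz ne \<open>card S = 5\<close> fin by (simp add: card_Diff_subset)
  then obtain d e where de: "S - {x, y, z} = {d, e}" "d \<noteq> e"
    by (auto simp: card_2_iff)
  then have S: "S = {x, y, z, d, e}"
    using xyz by blast
  have dist: "distinct [x, y, z, d, e]"
    using xyz ne de by auto
  have C: "\<And>a b c d' e'. S = {a, b, c, d', e'} \<Longrightarrow> distinct [a, b, c, d', e'] \<Longrightarrow> a \<frown> b \<Longrightarrow> b \<frown> c \<Longrightarrow> d' \<frown> e'"
    using uncuttable5_complement[OF unc] by blast
  have de_adj: "d \<frown> e"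
    using C[of x y z d e] S dist xyz by blast
  have yd: "\<not> y \<frown> d"
    using C[of y d e x z] S dist xyz de_adj by auto
  have ye: "\<not> y \<frown> e"
    using C[of y e d x z] S dist xyz de_adj adj_sym[of d e] by auto
  \<comment> \<open>The roles of \<open>d\<close> and \<open>e\<close>, and those of \<open>x\<close> and \<open>z\<close>, are interchangeable.\<close>
  have cyc: thesis if h: "{d', e'} = {d, e}" "{x', z'} = {x, z}" "d' \<frown> x'" for d' e' x' z'
  proof -
    have S': "S = {x', y, z', d', e'}" and dist': "distinct [x', y, z', d', e']"
      using S dist h(1,2) by (auto simp: doubleton_eq_iff)
    have adj': "x' \<frown> y" "y \<frown> z'" "\<not> x' \<frown> z'" "\<not> y \<frown> d'" "\<not> y \<frown> e'" "d' \<frown> e'"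
      using h(1,2) xyz yd ye de_adj adj_sym unfolding doubleton_eq_iff by metis+
    have dz: "\<not> d' \<frown> z'"
    proof
      assume "d' \<frown> z'"
      then have "y \<frown> e'"
        using C[of x' d' z' y e'] S' dist' h(3) adj_sym[of x' d'] by auto
      then show False using adj' by blast
    qed
    have ex: "\<not> e' \<frown> x'"
    proof
      assume "e' \<frown> x'"
      then have "d' \<frown> z'"
        using C[of e' x' y d' z'] S' dist' adj' by auto
      then show False using dz by blast
    qed
    have ez: "e' \<frown> z'"
      using C[of d' x' y e' z'] S' dist' adj' h(3) by auto
    show thesis
      by (rule found[of x' y z' e' d'])
        (use S' dist' adj' dz ex ez h(3) adj_sym[of z' e'] adj_sym[of e' d'] adj_sym[of z' d'] adj_sym[of e' x']
          adj_sym[of d' y] in \<open>auto simp: five_cycle_def\<close>)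
  qed
  have sub: "{d, e} \<subseteq> S" "x \<notin> {d, e}"
    using S dist by auto
  obtain x' y' where x'y': "x' \<in> {d, e}" "y' \<in> S" "y' \<notin> {d, e}" "x' \<frown> y'"
    by (rule linkedD[OF uncuttable_linked[OF unc] sub(1), of d x]) (use sub(2) \<open>x \<in> S\<close> in auto)
  have "y' \<in> {x, y, z}"
    using x'y' S by blast
  moreover have "y' \<noteq> y"
    using x'y'(1,4) yd ye adj_sym by blast
  ultimately show thesis
    using x'y'(1,4) cyc[of d e x z, OF refl refl] cyc[of d e z x, OF refl insert_commute]
      cyc[of e d x z, OF insert_commute refl] cyc[of e d z x, OF insert_commute insert_commute] by blast
qed

text \<open>
  How an edge \<open>ab\<close> and a path \<open>p - q - r\<close> can fit together in an uncuttable set: if it is a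
  five-cycle, then \<open>p\<close>, \<open>q\<close>, \<open>r\<close> are consecutive on it and \<open>a\<close>, \<open>b\<close> close it, so that \<open>a\<close> is
  adjacent to exactly one end of the path, and \<open>b\<close> only to the other one.
\<close>

lemma uncuttable5_dichotomy:
  assumes "uncuttable {a, b, p, q, r}" "distinct [a, b, p, q, r]" "a \<frown> b" "p \<frown> q" "q \<frown> r"
  shows "complete_on {a, b, p, q, r} \<or>
    (\<not> p \<frown> r \<and> \<not> a \<frown> q \<and> (a \<frown> p \<longleftrightarrow> \<not> a \<frown> r) \<and> (a \<frown> p \<longleftrightarrow> \<not> b \<frown> p))"
proof (cases "complete_on {a, b, p, q, r}")
  case False
  have "card {a, b, p, q, r} = 5"
    using assms(2) by simp
  with False obtain v w x y z where *: "{a, b, p, q, r} = {v, w, x, y, z}" "five_cycle v w x y z"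
    using uncuttable5[OF assms(1)] by metis
  have "q \<in> {v, w, x, y, z}"
    using *(1) by blast
  then obtain c d e f where cyc: "{a, b, p, q, r} = {q, c, d, e, f}" "five_cycle q c d e f"
    using five_cycle_start_at[OF *(2)] *(1) by metis
  have q: "\<not> q \<frown> d" "\<not> q \<frown> e" "q \<frown> p" "q \<frown> r"
    using cyc(2) assms(4,5) adj_sym unfolding five_cycle_def by blast+
  have mem: "p \<in> {q, c, d, e, f}" "r \<in> {q, c, d, e, f}" "a \<in> {q, c, d, e, f}" "b \<in> {q, c, d, e, f}"
    using cyc(1) by blast+
  have pr: "p = c \<and> r = f \<or> p = f \<and> r = c"
    using mem(1,2) q assms(2) by auto
  then have "a = d \<and> b = e \<or> a = e \<and> b = d"
    using mem(3,4) assms(2) by auto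
  with pr show ?thesis
    using cyc(2) adj_sym[of c f] adj_sym[of d q] adj_sym[of d c] adj_sym[of e c]
    unfolding five_cycle_def by (elim disjE conjE) simp_all
qed simp

text \<open>
  The complement of three consecutive vertices of the cycle is an edge of the cycle together with
  the path, to which \<open>uncuttable5_dichotomy\<close> applies.  If \<open>p\<close> and \<open>r\<close> are nonadjacent, then the
  vertices of the cycle would have to be alternately adjacent and nonadjacent to \<open>p\<close>, which the odd
  length forbids.  If \<open>p\<close> and \<open>r\<close> are adjacent, then all these sets are complete, and the removal of
  \<open>p\<close>, \<open>q\<close> and one vertex of the cycle leads to a contradiction.
\<close>

lemma uncuttable8_not_five_cycle:
  assumes unc: "uncuttable S" and S: "S = {c0, c1, c2, c3, c4, p, q, r}"
    and dist: "distinct [c0, c1, c2, c3, c4, p, q, r]"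
    and cyc: "five_cycle c0 c1 c2 c3 c4" and pqr: "p \<frown> q" "q \<frown> r"
  shows False
proof -
  define dich where "dich a b \<longleftrightarrow> complete_on {a, b, p, q, r} \<or>
    (\<not> p \<frown> r \<and> \<not> a \<frown> q \<and> (a \<frown> p \<longleftrightarrow> \<not> a \<frown> r) \<and> (a \<frown> p \<longleftrightarrow> \<not> b \<frown> p))" for a b
  have step: "dich a b"
    if c: "five_cycle a b c d e" "{a, b, c, d, e} = {c0, c1, c2, c3, c4}" for a b c d e
  proof -
    have T: "c \<frown> d" "d \<frown> e" "a \<frown> b" "distinct [a, b, c, d, e]"
      using c(1) unfolding five_cycle_def by auto
    have new: "{p, q, r} \<inter> {a, b, c, d, e} = {}" "distinct [p, q, r]"
      using dist unfolding c(2) by auto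
    have S': "S = {a, b, c, d, e} \<union> {p, q, r}"
      unfolding c(2) S by auto
    have "S - {c, d, e} = {a, b, p, q, r}"
      using S' new T(4) by auto
    moreover have "uncuttable (S - {c, d, e})"
      using T S' by (intro uncuttable_diff3[OF unc]) auto
    moreover have "distinct [a, b, p, q, r]"
      using new T(4) by auto
    ultimately show ?thesis
      unfolding dich_def using uncuttable5_dichotomy T(3) pqr by metis
  qed
  note cyc1 = five_cycle_rotate[OF cyc]
  note cyc2 = five_cycle_rotate[OF cyc1]
  note cyc3 = five_cycle_rotate[OF cyc2]
  note cyc4 = five_cycle_rotate[OF cyc3]
  have d: "dich c0 c1" "dich c1 c2" "dich c2 c3" "dich c3 c4" "dich c4 c0"
    using step[OF cyc] step[OF cyc1] step[OF cyc2] step[OF cyc3] step[OF cyc4] by auto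
  show False
  proof (cases "p \<frown> r")
    case True
    then have "complete_on {c0, c1, p, q, r}" "complete_on {c1, c2, p, q, r}"
      using d(1,2) unfolding dich_def by auto
    moreover have "q \<noteq> c0" "c1 \<noteq> r" "r \<noteq> c2"
      using dist by auto
    ultimately have adj: "q \<frown> c0" "c1 \<frown> r" "r \<frown> c2"
      unfolding complete_on_def by simp_all
    \<comment> \<open>In the residual set, \<open>r\<close> is adjacent to the whole path left of the cycle,
      which is neither complete nor a five-cycle.\<close>
    have "S - {p, q, c0} = {c1, r, c2, c3, c4}"
      using S dist by auto
    moreover have "uncuttable (S - {p, q, c0})"
      using S dist pqr adj by (intro uncuttable_diff3[OF unc]) auto
    ultimately have unc': "uncuttable {c1, r, c2, c3, c4}"
      by simp
    have path: "distinct [c1, r, c2, c3, c4]" "c1 \<frown> c2" "c2 \<frown> c3" "c3 \<frown> c4" "\<not> c1 \<frown> c3" "c1 \<noteq> c3"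
      using dist cyc unfolding five_cycle_def by auto
    have "\<not> complete_on {c1, r, c2, c3, c4}"
      using path(5,6) unfolding complete_on_def by blast
    then have "c1 \<frown> c2 \<longleftrightarrow> \<not> r \<frown> c2"
      using uncuttable5_dichotomy[OF unc' path(1) adj(2) path(3,4)] by blast
    then show False
      using adj(3) path(2) by blast
  next
    case False
    have "\<not> complete_on {a, b, p, q, r}" for a b
      using False dist unfolding complete_on_def by auto
    then show False
      using d unfolding dich_def by blast
  qed
qed

lemma mod_3_eq_2_cases:
  fixes n :: nat
  assumes "n mod 3 = 2"
  shows "n = 2 \<or> n = 5 \<or> n \<ge> 8"
  using assms by presburger

lemma uncuttable_imp_complete_or_five_cycle:
  assumes "finite S" "uncuttable S" "card S mod 3 = 2"
  shows "complete_on S \<or> (\<exists>a b c d e. S = {a, b, c, d, e} \<and> five_cycle a b c d e)"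
  using assms
proof (induction S rule: finite_psubset_induct)
  case (psubset S)
  note unc = \<open>uncuttable S\<close>
  consider "card S = 2" | "card S = 5" | "card S \<ge> 8"
    using psubset.prems(2) by (metis mod_3_eq_2_cases)
  then show ?case
  proof cases
    case 1
    then obtain a b where S: "S = {a, b}" "a \<noteq> b"
      by (auto simp: card_2_iff)
    then obtain y where "y \<in> S" "a \<frown> y"
      using linked_imp_neighbor[OF uncuttable_linked[OF unc], of a b] by blast
    then have "a \<frown> b"
      using S not_adj_refl by blast
    then show ?thesis
      using S adj_sym[of a b] unfolding complete_on_def by auto
  next
    case 2
    then show ?thesis
      using uncuttable5[OF unc] by metis
  next
    case 3
    have residual: "complete_on (S - T) \<or> (\<exists>a b c d e. S - T = {a, b, c, d, e} \<and> five_cycle a b c d e)"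
      and card_residual: "card (S - T) = card S - 3"
      if T: "path_triple T" "T \<subseteq> S" for T
    proof -
      show card_eq: "card (S - T) = card S - 3"
        using T card_path_triple psubset.hyps by (simp add: card_Diff_subset finite_subset)
      then have "card (S - T) mod 3 = 2"
        using 3 psubset.prems(2) by (simp add: le_mod_geq)
      moreover have "T \<noteq> {}"
        using card_path_triple[OF T(1)] by auto
      then have "S - T \<subset> S"
        using T(2) by blast
      ultimately show "complete_on (S - T) \<or> (\<exists>a b c d e. S - T = {a, b, c, d, e} \<and> five_cycle a b c d e)"
        using psubset.IH[of "S - T"] uncuttable_diff[OF unc] T by blast
    qed
    have complete: "complete_on (S - T)" if T: "path_triple T" "T \<subseteq> S" for T
    proof (rule ccontr)
      assume "\<not> complete_on (S - T)"
      then obtain a b c d e where c: "S - T = {a, b, c, d, e}" "five_cycle a b c d e"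
        using residual[OF T] by blast
      obtain p q r where t: "T = {p, q, r}" "p \<noteq> r" "p \<frown> q" "q \<frown> r"
        using T unfolding path_triple_def by blast
      have "S = {a, b, c, d, e} \<union> {p, q, r}" "{a, b, c, d, e} \<inter> {p, q, r} = {}"
        using c t T(2) by blast+
      moreover have "p \<noteq> q" "q \<noteq> r"
        using t not_adj_refl by auto
      moreover have "distinct [a, b, c, d, e]"
        using c(2) unfolding five_cycle_def by blast
      ultimately show False
        using t(2) by (intro uncuttable8_not_five_cycle[OF unc _ _ c(2) t(3,4)]) auto
    qed
    have "complete_on S"
      unfolding complete_on_def
    proof (intro ballI impI)
      fix x z assume xz: "x \<in> S" "z \<in> S" "x \<noteq> z"
      \<comment> \<open>At least five vertices are left after removing \<open>T\<close>, so three of them differ from \<open>x\<close> and \<open>z\<close>;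
        they carry a path because the residual set is complete.\<close>
      obtain T where T: "T \<subseteq> S" "path_triple T"
        by (rule linked_imp_path_triple[OF uncuttable_linked[OF unc]]) (use 3 in auto)
      have "card (S - T - {x, z}) \<ge> 3"
        using card_residual[OF T(2,1)] 3 diff_card_le_card_Diff[of "{x, z}" "S - T"] xz by simp
      then obtain T' where T': "T' \<subseteq> S - T - {x, z}" "card T' = 3"
        using obtain_subset_with_card_n by metis
      then obtain a b c where abc: "T' = {a, b, c}" "a \<noteq> b" "b \<noteq> c" "a \<noteq> c"
        by (auto simp: card_3_iff)
      then have "path_triple T'"
        using complete[OF T(2,1)] T'(1) path_tripleI[of a b c] unfolding complete_on_def by blast
      then have "complete_on (S - T')"
        using complete T'(1) by blast
      then show "x \<frown> z"
        using xz T'(1) unfolding complete_on_def by blast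
    qed
    then show ?thesis ..
  qed
qed

section \<open>A vertex far from two others\<close>

text \<open>
  The induction reduces to the case that every path triple meets \<open>{u, v, w}\<close> (\<open>outside\<close>).  Then
  two-step walks outside \<open>{u, v, w}\<close> return to their start, and bridges \<open>u - a - b - t\<close> with different
  \<open>a\<close> have different \<open>b\<close>.  A bridge exists because the set itself is connected; each further claim
  follows since the removal of one or two triples must not disconnect the set.
\<close>

lemma uncuttable_no_far_triple:
  assumes "finite V" "uncuttable V" "{u, v, w} \<subseteq> V"
    and vw: "v \<noteq> w" "u \<noteq> v" "u \<noteq> w"
    and far: "\<And>x. u \<frown> x \<Longrightarrow> x \<notin> {v, w} \<and> \<not> v \<frown> x \<and> \<not> w \<frown> x"
  shows False
  using assms(1-3)
proof (induction V rule: finite_psubset_induct)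
  case (psubset S)
  note unc = \<open>uncuttable S\<close> and uvw = \<open>{u, v, w} \<subseteq> S\<close>
  have outside: False
    if "x \<frown> y" "y \<frown> z" "x \<noteq> z" "{x, y, z} \<subseteq> S - {u, v, w}" for x y z
    using psubset.IH[of "S - {x, y, z}"] uncuttable_diff3[OF unc that(1-3)] that(4) uvw by blast
  \<comment> \<open>The members of \<open>A\<close> are adjacent neither to \<open>v\<close> nor to \<open>w\<close>, so a bridge is a shortest
    connection from \<open>u\<close> to \<open>{v, w}\<close>.\<close>
  define A where "A = {a \<in> S. u \<frown> a}"
  define bridge where
    "bridge a b t \<longleftrightarrow> a \<in> A \<and> b \<in> S \<and> b \<notin> {u, v, w} \<and> t \<in> {v, w} \<and> a \<frown> b \<and> b \<frown> t" for a b t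
  have A: "a \<in> S" "a \<notin> {u, v, w}" "u \<frown> a" "\<not> a \<frown> v" "\<not> a \<frown> w" "\<not> v \<frown> a" "\<not> w \<frown> a"
    if "a \<in> A" for a
    using that far[of a] not_adj_refl adj_sym[of a v] adj_sym[of a w] unfolding A_def by auto
  have B: "b \<notin> A" "b \<in> S" "b \<notin> {u, v, w}" "t \<in> {v, w}" "a \<in> A" "a \<frown> b" "b \<frown> t" "\<not> u \<frown> b" if "bridge a b t" for a b t
    using that A(4,5)[of b] unfolding bridge_def A_def by auto
  have nbr: "y = u \<or> y = b" if "bridge a b t" "y \<in> S" "a \<frown> y" for a b t y
  proof (rule ccontr)
    assume y: "\<not> (y = u \<or> y = b)"
    have "{y, a, b} \<subseteq> S - {u, v, w}"
      using y A[OF B(5)[OF that(1)]] B(2,3)[OF that(1)] that(2,3) by auto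
    then show False
      using outside[of y a b] that(3) B(6)[OF that(1)] y adj_sym[of y a] by blast
  qed
  have inj: "b \<noteq> b'" if "bridge a b t" "bridge a' b' t'" "a \<noteq> a'" for a b t a' b' t'
  proof
    assume "b = b'"
    then show False
      using outside[of a b a'] that(3) B[OF that(1)] B[OF that(2)] A[of a] A[of a'] adj_sym[of a' b] by auto
  qed
  have ex_bridge: "\<exists>a b t. bridge a b t"
  proof -
    \<comment> \<open>The vertices reached from \<open>u\<close> by going to \<open>A\<close> and one step further outside \<open>{v, w}\<close>: an edge that
      leaves this set can only end in \<open>v\<close> or \<open>w\<close>.\<close>
    define X where "X = insert u (A \<union> {y \<in> S. y \<notin> {u, v, w} \<and> (\<exists>a\<in>A. a \<frown> y)})"
    obtain x y where xy: "x \<in> X" "y \<in> S" "y \<notin> X" "x \<frown> y"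
      by (rule linkedD[OF uncuttable_linked[OF unc], of X u v])
        (use uvw vw A(2)[of v] in \<open>auto simp: X_def A_def\<close>)
    have "x \<noteq> u"
      using xy unfolding X_def A_def by auto
    moreover have "x \<notin> A"
    proof
      assume x: "x \<in> A"
      then have "y \<notin> {u, v, w}"
        using xy A(4,5)[OF x] unfolding X_def by auto
      then show False
        using xy x unfolding X_def by blast
    qed
    ultimately obtain a where a: "a \<in> A" "a \<frown> x" "x \<in> S" "x \<notin> {u, v, w}"
      using xy(1) unfolding X_def by auto
    have "y \<in> {v, w}"
    proof (rule ccontr)
      assume "y \<notin> {v, w}"
      then have "{a, x, y} \<subseteq> S - {u, v, w}"
        using xy a A[OF a(1)] unfolding X_def by auto
      moreover have "a \<noteq> y"
        using xy(3) a(1) unfolding X_def by auto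
      ultimately show False
        using outside a(2) xy(4) by blast
    qed
    then show ?thesis
      using a xy(4) unfolding bridge_def by blast
  qed
  have all_bridge: "\<exists>b t. bridge a b t" if a: "a \<in> A" for a
  proof -
    obtain a0 b0 t0 where 0: "bridge a0 b0 t0"
      using ex_bridge by blast
    show ?thesis
    proof (cases "a = a0")
      case True
      then show ?thesis using 0 by blast
    next
      case False
      note B0 = B[OF 0] and A0 = A[OF B(5)[OF 0]]
      \<comment> \<open>Without \<open>u\<close>, \<open>a0\<close>, \<open>b0\<close>, the vertex \<open>a\<close> is still connected with \<open>v\<close>, and this requires a path
        \<open>a - x - y\<close> with \<open>y \<in> {v, w}\<close>.\<close>
      define X where "X = insert a {y \<in> S - {u, a0, b0}. y \<notin> {v, w} \<and> a \<frown> y}"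
      have "uncuttable (S - {u, a0, b0})"
        using B0 A0 uvw by (intro uncuttable_diff3[OF unc]) auto
      then obtain x y where xy: "x \<in> X" "y \<in> S - {u, a0, b0}" "y \<notin> X" "x \<frown> y"
        by (rule linkedD[OF uncuttable_linked, of "S - {u, a0, b0}" X a v])
          (use uvw vw A[OF a] B0(1,3) A0(2) a False in \<open>auto simp: X_def\<close>)
      have "x \<noteq> a"
        using xy A(4,5)[OF a] unfolding X_def by auto
      then have x: "a \<frown> x" "x \<in> S" "x \<notin> {u, v, w}"
        using xy(1) unfolding X_def by auto
      have "y \<in> {v, w}"
      proof (rule ccontr)
        assume "y \<notin> {v, w}"
        then have "{a, x, y} \<subseteq> S - {u, v, w}"
          using xy x A[OF a] by auto
        moreover have "a \<noteq> y"
          using xy(3) unfolding X_def by auto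
        ultimately show False
          using outside x(1) xy(4) by blast
      qed
      then show ?thesis
        using x xy(4) a unfolding bridge_def by blast
    qed
  qed
  have other: "\<exists>s. s \<noteq> t \<and> {v, w} = {t, s}" if "t \<in> {v, w}" for t
  proof (cases "t = v")
    case True
    then show ?thesis using vw(1) by (intro exI[of _ w]) auto
  next
    case False
    then show ?thesis using that by (intro exI[of _ v]) auto
  qed
  have no_shared: "a = a'" if br: "bridge a b t" "bridge a' b' t" for a a' b b' t
  proof (rule ccontr)
    assume ne: "a \<noteq> a'"
    note B1 = B[OF br(1)] and B2 = B[OF br(2)]
    note A1 = A[OF B1(5)] and A2 = A[OF B2(5)]
    have "b \<noteq> b'"
      using inj[OF br ne] .
    obtain s where s: "s \<noteq> t" "{v, w} = {t, s}"
      using other[OF B1(4)] by blast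
    then have ts: "t \<in> S" "s \<in> S" "s \<noteq> u" "t \<noteq> u" "a \<noteq> s" "a \<noteq> t" "a' \<noteq> s" "a' \<noteq> t" "b \<noteq> s" "b \<noteq> t" "b' \<noteq> s" "b' \<noteq> t"
      using uvw vw A1(2) A2(2) B1(3) B2(3) by auto
    \<comment> \<open>After removing \<open>b - t - b'\<close>, the vertices \<open>a\<close> and \<open>a'\<close> hang on \<open>u\<close> alone.  Connectedness with \<open>s\<close>
      yields a third bridge \<open>u - y - d\<close>; removing \<open>u - y - d\<close> as well isolates \<open>a\<close>.\<close>
    define S1 where "S1 = S - {b, t, b'}"
    have unc1: "uncuttable S1"
      unfolding S1_def using B1 B2 ts \<open>b \<noteq> b'\<close> adj_sym[of t b'] by (intro uncuttable_diff3[OF unc]) auto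
    have neqs: "a \<noteq> b" "a \<noteq> b'" "a' \<noteq> b" "a' \<noteq> b'" "a \<noteq> u" "a' \<noteq> u"
      using B1(1,5) B2(1,5) A1(2) A2(2) by auto
    have in_S1: "u \<in> S1" "a \<in> S1" "a' \<in> S1" "s \<in> S1"
      unfolding S1_def using uvw A1 A2 B1(3) B2(3) ts neqs s(1) by auto
    obtain x y where xy: "x \<in> {u, a, a'}" "y \<in> S1" "y \<notin> {u, a, a'}" "x \<frown> y"
      by (rule linkedD[OF uncuttable_linked[OF unc1], of "{u, a, a'}" u s]) (use in_S1 ts in auto)
    have "x = u"
      using xy nbr[OF br(1), of y] nbr[OF br(2), of y] unfolding S1_def by auto
    then have y: "y \<in> A"
      using xy unfolding A_def S1_def by auto
    then obtain d t' where br3: "bridge y d t'"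
      using all_bridge by blast
    note B3 = B[OF br3] and A3 = A[OF y]
    have d: "d \<noteq> b" "d \<noteq> b'"
      using inj[OF br3 br(1)] inj[OF br3 br(2)] xy(3) by auto
    have "d \<noteq> t" "d \<noteq> u" "d \<noteq> s"
      using B3(3) s(2) by auto
    have unc2: "uncuttable (S1 - {u, y, d})"
      using in_S1 xy(2) B3 A3 d \<open>d \<noteq> t\<close> unfolding S1_def
      by (intro uncuttable_diff3[OF unc1[unfolded S1_def]]) auto
    have "a \<in> S1 - {u, y, d}" "s \<in> S1 - {u, y, d}"
      using in_S1 xy(3) neqs B1(5) B3(1) ts \<open>d \<noteq> s\<close> A3(2) s(2) by auto
    then obtain z where "z \<in> S1 - {u, y, d}" "a \<frown> z"
      using linked_imp_neighbor[OF uncuttable_linked[OF unc2], of a s] ts(5) by blast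
    then show False
      using nbr[OF br(1), of z] unfolding S1_def by auto
  qed
  obtain a b t where br: "bridge a b t"
    using ex_bridge by blast
  note B1 = B[OF br] and A1 = A[OF B(5)[OF br]]
  obtain s where s: "s \<noteq> t" "{v, w} = {t, s}"
    using other[OF B1(4)] by blast
  then have ts: "t \<in> S" "s \<in> S" "s \<noteq> u" "t \<noteq> u" "a \<noteq> s" "a \<noteq> t" "b \<noteq> s" "b \<noteq> t"
    using uvw vw A1(2) B1(3) by auto
  \<comment> \<open>Removing \<open>a - b - t\<close> must not isolate \<open>u\<close>, so there is a second bridge, and it ends in \<open>s\<close>.\<close>
  have unc1: "uncuttable (S - {a, b, t})"
    using B1 A1 ts by (intro uncuttable_diff3[OF unc]) auto
  have "u \<in> S - {a, b, t}" "s \<in> S - {a, b, t}"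
    using uvw ts s(1) A1(2) B1(3) by auto
  then obtain a' where a': "a' \<in> S - {a, b, t}" "u \<frown> a'"
    using linked_imp_neighbor[OF uncuttable_linked[OF unc1], of u s] ts(3) by blast
  then have a'A: "a' \<in> A" "a' \<noteq> a"
    unfolding A_def by auto
  then obtain b' t' where br': "bridge a' b' t'"
    using all_bridge by blast
  note B2 = B[OF br'] and A2 = A[OF a'A(1)]
  have "t' \<noteq> t"
    using no_shared[OF br, of a' b'] br' a'A(2) by blast
  then have "t' = s"
    using B2(4) s(2) by blast
  have "b' \<noteq> b"
    using inj[OF br br'] a'A(2) by blast
  have neqs: "a' \<noteq> s" "a' \<noteq> b'" "b' \<noteq> s" "b' \<noteq> t" "b' \<noteq> a" "b' \<noteq> u" "a' \<noteq> u"
    using A2(2) B2(1,3,5) s(2) a'A(1) B1(5) by auto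
  \<comment> \<open>Removing both bridges except for \<open>u\<close> must not isolate \<open>u\<close> either, nor leave \<open>u\<close> as the only
    vertex.  The third bridge obtained in this way shares its end with one of the others.\<close>
  define S2 where "S2 = S - {a, b, t} - {a', b', s}"
  have unc2: "uncuttable S2"
    unfolding S2_def using B2 a'(1) ts s(1) neqs \<open>b' \<noteq> b\<close> \<open>t' = s\<close>
    by (intro uncuttable_diff3[OF unc1]) auto
  have "u \<in> S2"
    unfolding S2_def using uvw A1(2) A2(2) B1(3) B2(3) ts by auto
  then obtain q where "q \<in> S2" "q \<noteq> u"
    using uncuttable_card[OF unc2] by (metis is_singletonI' is_singleton_altdef empty_iff)
  then obtain y where y: "y \<in> S2" "u \<frown> y"
    using linked_imp_neighbor[OF uncuttable_linked[OF unc2] \<open>u \<in> S2\<close>, of q] by blast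
  then have "y \<in> A" "y \<noteq> a" "y \<noteq> a'"
    unfolding A_def S2_def by auto
  then obtain d r where br3: "bridge y d r"
    using all_bridge by blast
  then have "r = t \<or> r = s"
    using B(4) s(2) by blast
  then show False
    using no_shared br br' br3 \<open>t' = s\<close> \<open>y \<noteq> a\<close> \<open>y \<noteq> a'\<close> by blast
qed

end

section \<open>The five-cycle up to isomorphism\<close>

text \<open>
  Arcs of pair digraphs are determined by their ends, so that an isomorphism is given by its vertex map.
\<close>

lemma digraph_iso_with_proj_iff:
  "digraph_iso (with_proj G) (with_proj H) \<longleftrightarrow> pair_wf_digraph G \<and>
    (\<exists>f. inj_on f (pverts G) \<and> pverts H = f ` pverts G \<and> parcs H = map_prod f f ` parcs G)"
proof
  assume "digraph_iso (with_proj G) (with_proj H)"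
  then obtain h where h: "pre_digraph.digraph_isomorphism (with_proj G) h" "with_proj H = app_iso h (with_proj G)"
    unfolding digraph_iso_def by blast
  then have wf: "pair_wf_digraph G" and inj: "inj_on (iso_verts h) (pverts G)"
    and ends: "\<forall>a\<in>parcs G. iso_verts h (fst a) = iso_tail h (iso_arcs h a) \<and> iso_verts h (snd a) = iso_head h (iso_arcs h a)"
    unfolding pre_digraph.digraph_isomorphism_def by (auto simp: wf_digraph_wp_iff)
  have H: "pverts H = iso_verts h ` pverts G" "parcs H = iso_arcs h ` parcs G" "fst = iso_tail h" "snd = iso_head h"
    using arg_cong[OF h(2), of verts] arg_cong[OF h(2), of arcs] arg_cong[OF h(2), of tail] arg_cong[OF h(2), of head]
    by simp_all
  have "parcs H = map_prod (iso_verts h) (iso_verts h) ` parcs G"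
    unfolding H(2) using ends unfolding H(3,4)[symmetric] by (intro image_cong) (auto intro: prod_eqI)
  then show "pair_wf_digraph G \<and>
    (\<exists>f. inj_on f (pverts G) \<and> pverts H = f ` pverts G \<and> parcs H = map_prod f f ` parcs G)"
    using wf inj H(1) by blast
next
  assume "pair_wf_digraph G \<and>
    (\<exists>f. inj_on f (pverts G) \<and> pverts H = f ` pverts G \<and> parcs H = map_prod f f ` parcs G)"
  then obtain f where wf: "pair_wf_digraph G"
    and f: "inj_on f (pverts G)" "pverts H = f ` pverts G" "parcs H = map_prod f f ` parcs G"
    by blast
  define h :: "('a, 'a \<times> 'a, 'b, 'b \<times> 'b) digraph_isomorphism" where
    "h = \<lparr>iso_verts = f, iso_arcs = map_prod f f, iso_head = snd, iso_tail = fst\<rparr>"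
  have "parcs G \<subseteq> pverts G \<times> pverts G"
    using wf unfolding pair_wf_digraph_def by auto
  then have "inj_on (map_prod f f) (parcs G)"
    using map_prod_inj_on[OF f(1) f(1)] inj_on_subset by blast
  then have "pre_digraph.digraph_isomorphism (with_proj G) h"
    unfolding pre_digraph.digraph_isomorphism_def using wf f(1) by (auto simp: h_def wf_digraph_wp_iff)
  moreover have "with_proj H = app_iso h (with_proj G)"
    using f(2,3) by (simp add: with_proj_def app_iso_def h_def)
  ultimately show "digraph_iso (with_proj G) (with_proj H)"
    unfolding digraph_iso_def by blast
qed

lemma cycle_graph_5:
  "pverts (cycle_graph 5) = {0, 1, 2, 3, 4}"
  "parcs (cycle_graph 5) = {(0,1), (1,2), (2,3), (3,4), (4,0), (1,0), (2,1), (3,2), (4,3), (0,4)}"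
proof -
  have less5: "i < 5 \<longleftrightarrow> i = 0 \<or> i = 1 \<or> i = 2 \<or> i = 3 \<or> i = 4" for i :: nat
    by auto
  show "pverts (cycle_graph 5) = {0, 1, 2, 3, 4}"
    by (auto simp: cycle_graph_def less5)
  show "parcs (cycle_graph 5) = {(0,1), (1,2), (2,3), (3,4), (4,0), (1,0), (2,1), (3,2), (4,3), (0,4)}" (is "_ = ?E")
  proof (intro set_eqI, clarify)
    fix i j :: nat
    show "(i, j) \<in> parcs (cycle_graph 5) \<longleftrightarrow> (i, j) \<in> ?E"
    proof (cases "i < 5 \<and> j < 5")
      case True
      then show ?thesis
        unfolding less5 by (elim conjE disjE) (simp_all add: cycle_graph_def)
    next
      case False
      then show ?thesis
        by (auto simp: cycle_graph_def)
    qed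
  qed
qed

lemma (in pair_graph) digraph_iso_cycle_graph_5_iff:
  "digraph_iso (with_proj G) (with_proj (cycle_graph 5)) \<longleftrightarrow>
    (\<exists>a b c d e. pverts G = {a, b, c, d, e} \<and> five_cycle a b c d e)"
proof
  assume "digraph_iso (with_proj G) (with_proj (cycle_graph 5))"
  then obtain f where inj: "inj_on f (pverts G)" and V: "f ` pverts G = {0, 1, 2, 3, 4}"
    and E: "map_prod f f ` parcs G = parcs (cycle_graph 5)"
    unfolding digraph_iso_with_proj_iff cycle_graph_5(1)[symmetric] by metis
  have "0 \<in> f ` pverts G" "1 \<in> f ` pverts G" "2 \<in> f ` pverts G" "3 \<in> f ` pverts G" "4 \<in> f ` pverts G"
    unfolding V by simp_all
  then obtain a b c d e where v: "a \<in> pverts G" "b \<in> pverts G" "c \<in> pverts G" "d \<in> pverts G" "e \<in> pverts G"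
    and f: "f a = 0" "f b = 1" "f c = 2" "f d = 3" "f e = 4"
    unfolding image_iff by fastforce
  have "f ` {a, b, c, d, e} = f ` pverts G"
    using V f by simp
  then have "pverts G = {a, b, c, d, e}"
    using inj_on_image_eq_iff[OF inj, of "{a, b, c, d, e}" "pverts G"] v by simp
  moreover have adj_iff: "x \<frown> y \<longleftrightarrow> (f x, f y) \<in> parcs (cycle_graph 5)" if xy: "x \<in> pverts G" "y \<in> pverts G" for x y
  proof
    assume "(f x, f y) \<in> parcs (cycle_graph 5)"
    then obtain x' y' where "x' \<frown> y'" "f x' = f x" "f y' = f y"
      unfolding E[symmetric] by auto
    then show "x \<frown> y"
      using inj_onD[OF inj] in_arcsD1 in_arcsD2 xy by metis
  qed (auto simp: E[symmetric])
  have "five_cycle a b c d e"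
    unfolding five_cycle_def using f by (auto simp: adj_iff v cycle_graph_5(2))
  ultimately show "\<exists>a b c d e. pverts G = {a, b, c, d, e} \<and> five_cycle a b c d e"
    by blast
next
  assume "\<exists>a b c d e. pverts G = {a, b, c, d, e} \<and> five_cycle a b c d e"
  then obtain a b c d e where V: "pverts G = {a, b, c, d, e}" and cyc: "five_cycle a b c d e"
    by blast
  have dist: "distinct [a, b, c, d, e]"
    using cyc unfolding five_cycle_def by blast
  define f :: "'a \<Rightarrow> nat" where
    "f x = (if x = a then 0 else if x = b then 1 else if x = c then 2 else if x = d then 3 else 4)" for x
  have f: "f a = 0" "f b = 1" "f c = 2" "f d = 3" "f e = 4"
    using dist unfolding f_def by auto
  have "inj_on f (pverts G)"
    unfolding V inj_on_def by (simp add: f)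
  moreover have "pverts (cycle_graph 5) = f ` pverts G"
    unfolding V cycle_graph_5 by (simp add: f)
  moreover have "parcs G = {(a,b), (b,c), (c,d), (d,e), (e,a), (b,a), (c,b), (d,c), (e,d), (a,e)}"
  proof
    show "parcs G \<subseteq> {(a,b), (b,c), (c,d), (d,e), (e,a), (b,a), (c,b), (d,c), (e,d), (a,e)}"
    proof (rule subrelI)
      fix x y assume xy: "x \<frown> y"
      then have "x \<in> {a, b, c, d, e}" "y \<in> {a, b, c, d, e}"
        using in_arcsD1 in_arcsD2 V by blast+
      then show "(x, y) \<in> {(a,b), (b,c), (c,d), (d,e), (e,a), (b,a), (c,b), (d,c), (e,d), (a,e)}"
        using xy cyc not_adj_refl adj_sym[of c a] adj_sym[of d b] adj_sym[of e c] adj_sym[of a d] adj_sym[of b e]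
        unfolding five_cycle_def by (elim insertE emptyE) simp_all
    qed
  qed (use cyc arcs_symmetric in \<open>auto simp: five_cycle_def\<close>)
  then have "parcs (cycle_graph 5) = map_prod f f ` parcs G"
    unfolding cycle_graph_5 by (simp add: f)
  ultimately show "digraph_iso (with_proj G) (with_proj (cycle_graph 5))"
    unfolding digraph_iso_with_proj_iff using pair_wf_digraph by blast
qed

section \<open>Well-definedness of the structure connectivity\<close>

theorem theorem3p6:
  fixes G :: "'a pair_pre_digraph" and n :: nat
  assumes "pair_graph G"
    and "connected (with_proj G)"
    and "card (pverts G) = n"
    and "n \<ge> 3"
  shows "(n mod 3 = 1 \<longrightarrow> K12_structure_connectivity_well_defined G) \<and>
    (n mod 3 = 2 \<longrightarrow>
      (K12_structure_connectivity_well_defined G \<longleftrightarrow>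
        \<not> digraph_iso (with_proj G) (with_proj (cycle_graph 5)) \<and>
        \<not> K\<^bsub>n\<^esub> (with_proj G))) \<and>
    (n mod 3 = 0 \<and>
      (\<exists>u\<in>pverts G. \<exists>v\<in>pverts G. \<exists>w\<in>pverts G. u \<noteq> v \<and> u \<noteq> w \<and> v \<noteq> w \<and>
        neighborhood G u \<inter> (neighborhood2 G v w \<union> {v, w}) = {}) \<longrightarrow>
      K12_structure_connectivity_well_defined G)"
proof -
  interpret pair_graph G by fact
  let ?V = "pverts G"
  have fin: "finite ?V"
    by (rule pair_finite_verts)
  have linked: "linked ?V"
  proof -
    have "with_proj G \<restriction> ?V = with_proj G"
      using in_arcsD1 in_arcsD2 by (auto simp: induce_subgraph_def with_proj_def)
    moreover have "?V \<noteq> {}"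
      using assms(3,4) by auto
    ultimately show ?thesis
      using connected_induce_iff_linked[of ?V] assms(2) by simp
  qed
  have complete: "K\<^bsub>n\<^esub> (with_proj G) \<longleftrightarrow> complete_on ?V"
  proof
    assume "K\<^bsub>n\<^esub> (with_proj G)"
    then have "parcs G = {(x, y). (x, y) \<in> ?V \<times> ?V \<and> x \<noteq> y}"
      unfolding complete_digraph_pair_def by blast
    then show "complete_on ?V"
      unfolding complete_on_def by simp
  next
    assume "complete_on ?V"
    then have "x \<frown> y \<longleftrightarrow> (x, y) \<in> ?V \<times> ?V \<and> x \<noteq> y" for x y
      using in_arcsD1[of x y] in_arcsD2[of x y] not_adj_refl[of x] unfolding complete_on_def by blast
    then show "K\<^bsub>n\<^esub> (with_proj G)"
      using fin assms(3) unfolding complete_digraph_pair_def by auto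
  qed
  have 1: "\<not> uncuttable ?V" if "n mod 3 = 1"
    using uncuttable_card_mod_3[OF fin] that assms(3) by blast
  have 2: "uncuttable ?V \<longleftrightarrow> digraph_iso (with_proj G) (with_proj (cycle_graph 5)) \<or> K\<^bsub>n\<^esub> (with_proj G)"
    if "n mod 3 = 2"
  proof
    assume "uncuttable ?V"
    then show "digraph_iso (with_proj G) (with_proj (cycle_graph 5)) \<or> K\<^bsub>n\<^esub> (with_proj G)"
      using uncuttable_imp_complete_or_five_cycle[OF fin] that assms(3)
      unfolding complete digraph_iso_cycle_graph_5_iff by blast
  next
    assume "digraph_iso (with_proj G) (with_proj (cycle_graph 5)) \<or> K\<^bsub>n\<^esub> (with_proj G)"
    then show "uncuttable ?V"
      using complete_imp_uncuttable[OF fin] five_cycle_imp_uncuttable linked that assms(3)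
      unfolding complete digraph_iso_cycle_graph_5_iff by metis
  qed
  have 3: "\<not> uncuttable ?V"
    if uvw: "u \<in> ?V" "v \<in> ?V" "w \<in> ?V" "u \<noteq> v" "u \<noteq> w" "v \<noteq> w"
      and far: "neighborhood G u \<inter> (neighborhood2 G v w \<union> {v, w}) = {}" for u v w
  proof
    assume "uncuttable ?V"
    moreover have "x \<notin> {v, w} \<and> \<not> v \<frown> x \<and> \<not> w \<frown> x" if "u \<frown> x" for x
      using far that in_arcsD2[OF that] unfolding neighborhood_def neighborhood2_def by blast
    ultimately show False
      using uncuttable_no_far_triple[OF fin, of u v w] uvw by blast
  qed
  show ?thesis
    unfolding K12_well_defined_iff_not_uncuttable using 1 2 3 by blast
qed

end
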